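(* There are brace blocks, arising from abelian maps on finite nonabelian groups, with an arbitrarily large number of pairwise non-isomorphic groups: for every positive integer $N$ there exist a finite nonabelian group $G$ and an abelian map $\psi\in\mathrm{Ab}(G)$ such that at least $N$ of the groups $(G,\circ_n)$, $n\ge 0$, in the brace block determined by $\psi$ are pairwise non-isomorphic. Moreover, the number of possible solutions to the Yang-Baxter equation obtained using an abelian map is unbounded: for every positive integer $N$ there exist a finite nonabelian group $G$ and $\psi\in\mathrm{Ab}(G)$ whose brace block yields at least $N$ solutions, where solutions are counted through the pairwise non-isomorphic braces $(G,\circ_m,\circ_n)$ of the block (isomorphic braces, which give equivalent solutions, are counted only once), each such brace contributing its two solutions $R_{m,n}$ and $R'_{m,n}$ if $(G,\circ_m)$ is nonabelian, and its one solution $R_{m,n}=R'_{m,n}$ if $(G,\circ_m)$ is abelian.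
   Context: $G$ is written multiplicatively. $\mathrm{Ab}(G)$ is the set of abelian maps, i.e., group endomorphisms $\psi:G\to G$ whose image $\psi(G)$ is abelian. $\mathrm{Map}(G)$ is the set of all functions $G\to G$, with operations $(\phi+\chi)(g)=\phi(g)\chi(g)$, $(-\phi)(g)=\phi(g)^{-1}$, $\phi-\chi=\phi+(-\chi)$, and product $(\phi\chi)(g)=\phi(\chi(g))$; $1$ denotes the identity map, and $\phi^n$ the $n$-fold composite ($\phi^0=1$). For $\psi\in\mathrm{Ab}(G)$ and $n\ge 0$, $\psi_n=-(1-\psi)^n+1\in\mathrm{Map}(G)$, i.e. $\psi_n(g)=\big((1-\psi)^n(g)\big)^{-1}g$, where $(1-\psi)(g)=g\psi(g)^{-1}$. Define $g\circ_n h=g\,\psi_n(g^{-1})\,h\,\psi_n(g)$ for $g,h\in G$. A brace (skew left brace) is a triple $(B,\cdot,\circ)$ where $(B,\cdot)$ and $(B,\circ)$ are groups such that $x\circ(y\cdot z)=(x\circ y)\cdot x^{-1}\cdot(x\circ z)$ for all $x,y,z\in B$, with $x^{-1}$ the inverse in $(B,\cdot)$. Two braces $(B,\cdot,\circ)$ and $(B',\cdot',\circ')$ are isomorphic if there is a function $B\to B'$ which is both an isomorphism $(B,\cdot)\to(B',\cdot')$ and an isomorphism $(B,\circ)\to(B',\circ')$. A brace block is a set $B$ with binary operations $\{\circ_n:n\ge 0\}$ such that $(B,\circ_m,\circ_n)$ is a brace for all $m,n\ge 0$; the operations $\circ_n$ above make $G$ a brace block, the brace block determined by $\psi$. A set-theoretic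 solution to the Yang-Baxter equation on a set $B$ is a function $R:B\times B\to B\times B$ with $(R\times\mathrm{id})(\mathrm{id}\times R)(R\times\mathrm{id})=(\mathrm{id}\times R)(R\times\mathrm{id})(\mathrm{id}\times R)$. Writing $R(x,y)=(f_x(y),g_y(x))$, it is non-degenerate if all $f_x$ and $g_y$ are invertible maps $B\to B$; "solution" means non-degenerate set-theoretic solution. A set-theoretic solution on $B$ induces a solution $V\otimes V\to V\otimes V$ on the vector space $V$ with basis $B$; two set-theoretic solutions are equivalent if they induce the same vector space solution up to a choice of basis. A brace $(B,\cdot,\circ)$ gives solutions $R(x,y)=(x^{-1}(x\circ y),\ \overline{x^{-1}(x\circ y)}\circ x\circ y)$ and $R'(x,y)=((x\circ y)x^{-1},\ \overline{(x\circ y)x^{-1}}\circ x\circ y)$, where $\overline{x}$ is the inverse of $x$ in $(B,\circ)$; $R=R'$ if and only if $(B,\cdot)$ is abelian, and isomorphic braces give equivalent solutions. $R_{m,n}$ and $R'_{m,n}$ denote these two solutions for the brace $(G,\circ_m,\circ_n)$. *)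

theory Defs
  imports "HOL-Algebra.Algebra"
begin

definition abelian_maps :: "('a, 'b) monoid_scheme \<Rightarrow> ('a \<Rightarrow> 'a) set" where
  "abelian_maps G = {\<psi> \<in> hom G G. comm_group (G\<lparr>carrier := \<psi> ` carrier G\<rparr>)}"

definition map_plus :: "('a, 'b) monoid_scheme \<Rightarrow> ('a \<Rightarrow> 'a) \<Rightarrow> ('a \<Rightarrow> 'a) \<Rightarrow> 'a \<Rightarrow> 'a" where
  "map_plus G \<phi> \<chi> = (\<lambda>g. \<phi> g \<otimes>\<^bsub>G\<^esub> \<chi> g)"

definition map_neg :: "('a, 'b) monoid_scheme \<Rightarrow> ('a \<Rightarrow> 'a) \<Rightarrow> 'a \<Rightarrow> 'a" where
  "map_neg G \<phi> = (\<lambda>g. inv\<^bsub>G\<^esub> (\<phi> g))"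

definition map_diff :: "('a, 'b) monoid_scheme \<Rightarrow> ('a \<Rightarrow> 'a) \<Rightarrow> ('a \<Rightarrow> 'a) \<Rightarrow> 'a \<Rightarrow> 'a" where
  "map_diff G \<phi> \<chi> = map_plus G \<phi> (map_neg G \<chi>)"

definition psi_seq :: "('a, 'b) monoid_scheme \<Rightarrow> ('a \<Rightarrow> 'a) \<Rightarrow> nat \<Rightarrow> 'a \<Rightarrow> 'a" where
  "psi_seq G \<psi> n = map_plus G (map_neg G ((map_diff G id \<psi>) ^^ n)) id"

definition circ_op :: "('a, 'b) monoid_scheme \<Rightarrow> ('a \<Rightarrow> 'a) \<Rightarrow> nat \<Rightarrow> 'a \<Rightarrow> 'a \<Rightarrow> 'a" where
  "circ_op G \<psi> n g h =
     g \<otimes>\<^bsub>G\<^esub> psi_seq G \<psi> n (inv\<^bsub>G\<^esub> g) \<otimes>\<^bsub>G\<^esub> h \<otimes>\<^bsub>G\<^esub> psi_seq G \<psi> n g"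

text \<open>All the operations share the identity element of \<open>G\<close>, since every \<open>\<psi>\<^sub>n\<close> fixes it.\<close>

definition circ_group :: "('a, 'b) monoid_scheme \<Rightarrow> ('a \<Rightarrow> 'a) \<Rightarrow> nat \<Rightarrow> 'a monoid" where
  "circ_group G \<psi> n = \<lparr>carrier = carrier G, monoid.mult = circ_op G \<psi> n, one = \<one>\<^bsub>G\<^esub>\<rparr>"

text \<open>A brace \<open>(B,\<cdot>,\<circ>)\<close> is given by the pair of group structures \<open>A = (B,\<cdot>)\<close>
  and \<open>C = (B,\<circ>)\<close> on a common carrier.\<close>

definition brace :: "'a monoid \<Rightarrow> 'a monoid \<Rightarrow> bool" where
  "brace A C \<longleftrightarrow> group A \<and> group C \<and> carrier C = carrier A \<and>
     (\<forall>x\<in>carrier A. \<forall>y\<in>carrier A. \<forall>z\<in>carrier A.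
        x \<otimes>\<^bsub>C\<^esub> (y \<otimes>\<^bsub>A\<^esub> z) = (x \<otimes>\<^bsub>C\<^esub> y) \<otimes>\<^bsub>A\<^esub> inv\<^bsub>A\<^esub> x \<otimes>\<^bsub>A\<^esub> (x \<otimes>\<^bsub>C\<^esub> z))"

definition brace_isomorphic ::
    "'a monoid \<times> 'a monoid \<Rightarrow> 'b monoid \<times> 'b monoid \<Rightarrow> bool" where
  "brace_isomorphic B B' \<longleftrightarrow>
     (\<exists>f. f \<in> iso (fst B) (fst B') \<and> f \<in> iso (snd B) (snd B'))"

definition brace_block :: "(nat \<Rightarrow> 'a monoid) \<Rightarrow> bool" where
  "brace_block H \<longleftrightarrow> (\<forall>m n. brace (H m) (H n))"

definition on_first_two :: "('a \<times> 'a \<Rightarrow> 'a \<times> 'a) \<Rightarrow> 'a \<times> 'a \<times> 'a \<Rightarrow> 'a \<times> 'a \<times> 'a" where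
  "on_first_two R = (\<lambda>(x, y, z). (fst (R (x, y)), snd (R (x, y)), z))"

definition on_last_two :: "('a \<times> 'a \<Rightarrow> 'a \<times> 'a) \<Rightarrow> 'a \<times> 'a \<times> 'a \<Rightarrow> 'a \<times> 'a \<times> 'a" where
  "on_last_two R = map_prod id R"

definition set_theoretic_solution :: "'a set \<Rightarrow> ('a \<times> 'a \<Rightarrow> 'a \<times> 'a) \<Rightarrow> bool" where
  "set_theoretic_solution B R \<longleftrightarrow> R \<in> B \<times> B \<rightarrow> B \<times> B \<and>
     (\<forall>t \<in> B \<times> B \<times> B.
        (on_first_two R \<circ> on_last_two R \<circ> on_first_two R) t =
        (on_last_two R \<circ> on_first_two R \<circ> on_last_two R) t)"

definition nondegenerate :: "'a set \<Rightarrow> ('a \<times> 'a \<Rightarrow> 'a \<times> 'a) \<Rightarrow> bool" where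
  "nondegenerate B R \<longleftrightarrow>
     (\<forall>x\<in>B. bij_betw (\<lambda>y. fst (R (x, y))) B B) \<and>
     (\<forall>y\<in>B. bij_betw (\<lambda>x. snd (R (x, y))) B B)"

definition YB_solution :: "'a set \<Rightarrow> ('a \<times> 'a \<Rightarrow> 'a \<times> 'a) \<Rightarrow> bool" where
  "YB_solution B R \<longleftrightarrow> set_theoretic_solution B R \<and> nondegenerate B R"

text \<open>The maps attached to a brace are restricted to \<open>B \<times> B\<close>, so that equality of maps
  (hence counting them) only depends on their values on the underlying set.\<close>

definition brace_R :: "'a monoid \<Rightarrow> 'a monoid \<Rightarrow> 'a \<times> 'a \<Rightarrow> 'a \<times> 'a" where
  "brace_R A C = (\<lambda>(x, y) \<in> carrier A \<times> carrier A.
     (let u = inv\<^bsub>A\<^esub> x \<otimes>\<^bsub>A\<^esub> (x \<otimes>\<^bsub>C\<^esub> y)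
      in (u, inv\<^bsub>C\<^esub> u \<otimes>\<^bsub>C\<^esub> x \<otimes>\<^bsub>C\<^esub> y)))"

definition brace_R' :: "'a monoid \<Rightarrow> 'a monoid \<Rightarrow> 'a \<times> 'a \<Rightarrow> 'a \<times> 'a" where
  "brace_R' A C = (\<lambda>(x, y) \<in> carrier A \<times> carrier A.
     (let u = (x \<otimes>\<^bsub>C\<^esub> y) \<otimes>\<^bsub>A\<^esub> inv\<^bsub>A\<^esub> x
      in (u, inv\<^bsub>C\<^esub> u \<otimes>\<^bsub>C\<^esub> x \<otimes>\<^bsub>C\<^esub> y)))"

definition brace_solutions :: "'a monoid \<Rightarrow> 'a monoid \<Rightarrow> ('a \<times> 'a \<Rightarrow> 'a \<times> 'a) set" where
  "brace_solutions A C =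
     (if comm_group A then {brace_R A C} else {brace_R A C, brace_R' A C})"

end

(* If psi has abelian image, then each psi_n is an endomorphism whose image lies in the abelian
   group psi(G); any two of the operations g psi_n(g)^{-1} h psi_n(g) then form a brace.

   For the semidirect product of Z_M by Z_K, where K = 2^N, M = 2^K - 1 and b in Z_K acts on Z_M
   as multiplication by 2^b, take psi(a, b) = (0, -b).  Then (1 - psi)(a, b) = (a, 2b), so the n-th
   operation is the semidirect product in which b acts as b 2^n did originally.  As 2 has order
   exactly 2^N modulo M, the centers of these groups increase strictly for n = 0, ..., N, so the
   groups are pairwise non-isomorphic.  The braces formed by the 0-th and the n-th operation are
   then pairwise non-isomorphic too, and each of them contributes at least one solution. *)

theory Submission
  imports Defs "HOL-Number_Theory.Cong" "HOL-Library.Nat_Bijection"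
begin

subsection \<open>Solutions of the Yang-Baxter equation from braces\<close>

lemma braceD:
  assumes "brace A C"
  shows "group A" "group C" "carrier C = carrier A"
    and "\<And>x y z. \<lbrakk>x \<in> carrier A; y \<in> carrier A; z \<in> carrier A\<rbrakk> \<Longrightarrow>
      x \<otimes>\<^bsub>C\<^esub> (y \<otimes>\<^bsub>A\<^esub> z) = (x \<otimes>\<^bsub>C\<^esub> y) \<otimes>\<^bsub>A\<^esub> inv\<^bsub>A\<^esub> x \<otimes>\<^bsub>A\<^esub> (x \<otimes>\<^bsub>C\<^esub> z)"
  using assms by (auto simp: brace_def)

locale skew_brace =
  fixes A C :: "'a monoid"
  assumes brace: "brace A C"
begin

sublocale A: group A by (rule braceD(1)[OF brace])
text \<open>Normalizing to one carrier lets the laws of both groups apply to the same membership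
  facts.\<close>

sublocale C: group C
  rewrites carrier_eq [simp]: "carrier C = carrier A"
  using braceD(2,3)[OF brace] by auto

text \<open>\<open>lam x\<close> and \<open>rho y\<close> are the maps f_x and g_y of R(x, y) =
  (f_x(y), g_y(x)). The index is the first argument, so that non-degeneracy is bijectivity of
  \<open>lam x\<close> and \<open>rho y\<close>.\<close>

definition lam :: "'a \<Rightarrow> 'a \<Rightarrow> 'a" where
  "lam x y = inv\<^bsub>A\<^esub> x \<otimes>\<^bsub>A\<^esub> (x \<otimes>\<^bsub>C\<^esub> y)"

definition rho :: "'a \<Rightarrow> 'a \<Rightarrow> 'a" where
  "rho y x = inv\<^bsub>C\<^esub> (lam x y) \<otimes>\<^bsub>C\<^esub> x \<otimes>\<^bsub>C\<^esub> y"

lemma lam_closed [simp]: "x \<in> carrier A \<Longrightarrow> y \<in> carrier A \<Longrightarrow> lam x y \<in> carrier A"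
  by (simp add: lam_def)

lemma rho_closed [simp]: "x \<in> carrier A \<Longrightarrow> y \<in> carrier A \<Longrightarrow> rho y x \<in> carrier A"
  by (simp add: rho_def)

lemma mult_lam: "x \<in> carrier A \<Longrightarrow> y \<in> carrier A \<Longrightarrow> x \<otimes>\<^bsub>A\<^esub> lam x y = x \<otimes>\<^bsub>C\<^esub> y"
  by (simp add: lam_def A.inv_solve_left' flip: A.m_assoc)

lemma lam_rho: "x \<in> carrier A \<Longrightarrow> y \<in> carrier A \<Longrightarrow> lam x y \<otimes>\<^bsub>C\<^esub> rho y x = x \<otimes>\<^bsub>C\<^esub> y"
  by (simp add: rho_def C.m_assoc flip: C.m_assoc[of "lam x y" "inv\<^bsub>C\<^esub> lam x y"])

text \<open>With all three arguments equal to the unit of \<open>A\<close>, the brace relation makes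
  \<open>?u\<close> idempotent in \<open>A\<close>, hence trivial. So the unit of \<open>A\<close>
  is idempotent in \<open>C\<close>.\<close>

lemma one_eq: "\<one>\<^bsub>C\<^esub> = \<one>\<^bsub>A\<^esub>"
proof -
  let ?u = "\<one>\<^bsub>A\<^esub> \<otimes>\<^bsub>C\<^esub> \<one>\<^bsub>A\<^esub>"
  have "?u = ?u \<otimes>\<^bsub>A\<^esub> ?u"
    using braceD(4)[OF brace, of "\<one>\<^bsub>A\<^esub>" "\<one>\<^bsub>A\<^esub>" "\<one>\<^bsub>A\<^esub>"] by simp
  then have "?u = \<one>\<^bsub>A\<^esub>"
    by (metis A.l_cancel_one' A.one_closed C.m_closed carrier_eq)
  then show ?thesis
    by (metis A.one_closed C.l_cancel_one' carrier_eq)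
qed

text \<open>This is the brace relation in another form. Writing o for the product of
  \<open>C\<close>, expand x o y o z as x o (y . \<open>lam y z\<close>) by that relation and cancel
  x o y in \<open>A\<close>.\<close>

lemma lam_lam:
  assumes [simp]: "x \<in> carrier A" "y \<in> carrier A" "z \<in> carrier A"
  shows "lam x (lam y z) = lam (x \<otimes>\<^bsub>C\<^esub> y) z"
proof -
  have "(x \<otimes>\<^bsub>C\<^esub> y) \<otimes>\<^bsub>A\<^esub> lam (x \<otimes>\<^bsub>C\<^esub> y) z = x \<otimes>\<^bsub>C\<^esub> (y \<otimes>\<^bsub>A\<^esub> lam y z)"
    by (simp add: mult_lam C.m_assoc)
  also have "\<dots> = (x \<otimes>\<^bsub>C\<^esub> y) \<otimes>\<^bsub>A\<^esub> lam x (lam y z)"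
    by (simp add: braceD(4)[OF brace] lam_def A.m_assoc)
  finally show ?thesis by simp
qed

lemma lam_one: "y \<in> carrier A \<Longrightarrow> lam \<one>\<^bsub>A\<^esub> y = y"
  using C.l_one[of y] by (simp add: lam_def one_eq)

text \<open>A product of \<open>C\<close> becomes a product of \<open>A\<close> once its left factor
  acts on the right one. Here \<open>lam x y\<close> then acts after \<open>rho y x\<close>, and
  together they act as the \<open>C\<close>-product of x and y.\<close>

lemma lam_mult:
  assumes [simp]: "x \<in> carrier A" "y \<in> carrier A" "z \<in> carrier A"
  shows "lam x (y \<otimes>\<^bsub>C\<^esub> z) = lam x y \<otimes>\<^bsub>C\<^esub> lam (rho y x) z"
proof -
  have "lam x y \<otimes>\<^bsub>C\<^esub> lam (rho y x) z = lam x y \<otimes>\<^bsub>A\<^esub> lam (x \<otimes>\<^bsub>C\<^esub> y) z"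
    by (simp add: lam_lam lam_rho flip: mult_lam[of "lam x y" "lam (rho y x) z"])
  also have "\<dots> = inv\<^bsub>A\<^esub> x \<otimes>\<^bsub>A\<^esub> ((x \<otimes>\<^bsub>C\<^esub> y) \<otimes>\<^bsub>A\<^esub> lam (x \<otimes>\<^bsub>C\<^esub> y) z)"
    by (simp add: lam_def[of x y] A.m_assoc)
  also have "\<dots> = lam x (y \<otimes>\<^bsub>C\<^esub> z)"
    by (simp add: mult_lam lam_def[of x] C.m_assoc)
  finally show ?thesis by simp
qed

text \<open>After multiplication by \<open>lam x (y o z)\<close> on the left, both sides become x o
  y o z, where o is the product of \<open>C\<close>.\<close>

lemma rho_rho:
  assumes [simp]: "x \<in> carrier A" "y \<in> carrier A" "z \<in> carrier A"
  shows "rho z (rho y x) = rho (y \<otimes>\<^bsub>C\<^esub> z) x"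
proof -
  have "lam x (y \<otimes>\<^bsub>C\<^esub> z) \<otimes>\<^bsub>C\<^esub> rho z (rho y x) = lam x y \<otimes>\<^bsub>C\<^esub> (rho y x \<otimes>\<^bsub>C\<^esub> z)"
    by (simp add: lam_mult C.m_assoc lam_rho)
  also have "\<dots> = lam x (y \<otimes>\<^bsub>C\<^esub> z) \<otimes>\<^bsub>C\<^esub> rho (y \<otimes>\<^bsub>C\<^esub> z) x"
    by (simp add: lam_rho C.m_assoc flip: C.m_assoc[of "lam x y"])
  finally show ?thesis by simp
qed

lemma rho_one: "x \<in> carrier A \<Longrightarrow> rho \<one>\<^bsub>A\<^esub> x = x"
  using C.r_one[of x] by (simp add: rho_def lam_def C.inv_one flip: one_eq)

lemma bij_betw_lam:
  assumes [simp]: "x \<in> carrier A"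
  shows "bij_betw (lam x) (carrier A) (carrier A)"
  by (rule bij_betwI[where g = "lam (inv\<^bsub>C\<^esub> x)"])
    (auto simp: lam_lam lam_one one_eq)

lemma bij_betw_rho:
  assumes [simp]: "y \<in> carrier A"
  shows "bij_betw (rho y) (carrier A) (carrier A)"
  by (rule bij_betwI[where g = "rho (inv\<^bsub>C\<^esub> y)"])
    (auto simp: rho_rho rho_one one_eq)

lemma brace_R_eq:
  "x \<in> carrier A \<Longrightarrow> y \<in> carrier A \<Longrightarrow> brace_R A C (x, y) = (lam x y, rho y x)"
  by (simp add: brace_R_def Let_def lam_def rho_def)

text \<open>Since \<open>lam\<close> is a left and \<open>rho\<close> a right action of \<open>C\<close>, the outer components of
  the braid relation agree; as \<open>R\<close> preserves the product of \<open>C\<close>, so do the middle ones.\<close>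

lemma YB_solution_brace_R: "YB_solution (carrier A) (brace_R A C)"
proof -
  let ?R = "brace_R A C"
  have "(on_first_two ?R \<circ> on_last_two ?R \<circ> on_first_two ?R) (x, y, z) =
        (on_last_two ?R \<circ> on_first_two ?R \<circ> on_last_two ?R) (x, y, z)"
    if [simp]: "x \<in> carrier A" "y \<in> carrier A" "z \<in> carrier A" for x y z
  proof -
    define u where "u = lam x y"
    define v where "v = rho y x"
    define p where "p = lam y z"
    define q where "q = rho z y"
    have [simp]: "u \<in> carrier A" "v \<in> carrier A" "p \<in> carrier A" "q \<in> carrier A"
      by (auto simp: u_def v_def p_def q_def)
    have uv: "u \<otimes>\<^bsub>C\<^esub> v = x \<otimes>\<^bsub>C\<^esub> y" and pq: "p \<otimes>\<^bsub>C\<^esub> q = y \<otimes>\<^bsub>C\<^esub> z"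
      by (auto simp: u_def v_def p_def q_def lam_rho)
    have first: "lam u (lam v z) = lam x p"
      by (simp add: lam_lam uv p_def)
    have third: "rho z v = rho q (rho p x)"
      by (simp add: rho_rho pq v_def)
    have "lam x p \<otimes>\<^bsub>C\<^esub> rho (lam v z) u \<otimes>\<^bsub>C\<^esub> rho z v = u \<otimes>\<^bsub>C\<^esub> v \<otimes>\<^bsub>C\<^esub> z"
      by (simp add: C.m_assoc lam_rho flip: first C.m_assoc[of "lam u (lam v z)"])
    also have "\<dots> = lam x p \<otimes>\<^bsub>C\<^esub> lam (rho p x) q \<otimes>\<^bsub>C\<^esub> rho z v"
      by (simp add: third C.m_assoc lam_rho pq uv)
        (simp add: lam_rho C.m_assoc pq flip: C.m_assoc[of "lam x p"])
    finally have "rho (lam v z) u = lam (rho p x) q"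
      by simp
    with first third show ?thesis
      by (simp add: on_first_two_def on_last_two_def brace_R_eq flip: u_def v_def p_def q_def)
  qed
  moreover have "bij_betw (\<lambda>y. fst (?R (x, y))) (carrier A) (carrier A)"
    if "x \<in> carrier A" for x
    using bij_betw_lam[OF that] that by (simp add: brace_R_eq cong: bij_betw_cong)
  moreover have "bij_betw (\<lambda>x. snd (?R (x, y))) (carrier A) (carrier A)"
    if "y \<in> carrier A" for y
    using bij_betw_rho[OF that] that by (simp add: brace_R_eq cong: bij_betw_cong)
  ultimately show ?thesis
    by (auto simp: YB_solution_def set_theoretic_solution_def nondegenerate_def brace_R_eq)
qed

end

section \<open>The opposite brace and the second solution R'\<close>

definition opposite :: "'a monoid \<Rightarrow> 'a monoid" where
  "opposite A = A\<lparr>monoid.mult := \<lambda>x y. y \<otimes>\<^bsub>A\<^esub> x\<rparr>"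

lemma opposite_simps [simp]:
  "carrier (opposite A) = carrier A" "\<one>\<^bsub>opposite A\<^esub> = \<one>\<^bsub>A\<^esub>"
  "x \<otimes>\<^bsub>opposite A\<^esub> y = y \<otimes>\<^bsub>A\<^esub> x" "inv\<^bsub>opposite A\<^esub> x = inv\<^bsub>A\<^esub> x"
  by (auto simp: opposite_def m_inv_def conj_commute)

lemma group_opposite:
  assumes "group A"
  shows "group (opposite A)"
proof -
  interpret group A by fact
  show ?thesis
    by (rule groupI) (auto simp: m_assoc intro: r_inv)
qed

text \<open>The brace relation with y and z exchanged, read in the reversed order of
  \<open>A\<close>, is the same relation again.\<close>

lemma brace_opposite:
  assumes "brace A C"
  shows "brace (opposite A) C"
proof -
  interpret skew_brace A C by standard fact
  show ?thesis
    using assms by (auto simp: brace_def group_opposite A.m_assoc)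
qed

text \<open>Reversing \<open>A\<close> keeps inverses and moves the factor inverse to x to the other
  side, so everything proved for R transfers to R'.\<close>

lemma brace_R'_eq: "brace_R' A C = brace_R (opposite A) C"
  by (simp add: brace_R_def brace_R'_def)

lemma YB_solution_brace_solutions:
  assumes "brace A C" "R \<in> brace_solutions A C"
  shows "YB_solution (carrier A) R"
  using assms skew_brace.YB_solution_brace_R[of A C]
    skew_brace.YB_solution_brace_R[OF skew_brace.intro, OF brace_opposite]
  by (auto simp: brace_solutions_def brace_R'_eq skew_brace_def split: if_splits)

subsection \<open>The brace block of an abelian map\<close>

locale abelian_map = group G for G (structure) +
  fixes \<psi>
  assumes abelian_map: "\<psi> \<in> abelian_maps G"
begin

text \<open>This is 1 - psi, in general not a homomorphism; the maps psi_n are, which is why the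
  computations below run through them.\<close>

abbreviation \<phi> :: "'a \<Rightarrow> 'a" where "\<phi> \<equiv> map_diff G id \<psi>"

lemma psi_hom: "\<psi> \<in> hom G G"
  using abelian_map by (simp add: abelian_maps_def)

lemma psi_closed [simp]: "g \<in> carrier G \<Longrightarrow> \<psi> g \<in> carrier G"
  by (rule hom_in_carrier[OF psi_hom])

lemma psi_mult: "g \<in> carrier G \<Longrightarrow> h \<in> carrier G \<Longrightarrow> \<psi> (g \<otimes> h) = \<psi> g \<otimes> \<psi> h"
  by (rule hom_mult[OF psi_hom])

lemma image_commute:
  assumes "a \<in> \<psi> ` carrier G" "b \<in> \<psi> ` carrier G"
  shows "a \<otimes> b = b \<otimes> a"
proof -
  interpret I: comm_group "G\<lparr>carrier := \<psi> ` carrier G\<rparr>"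
    using abelian_map by (simp add: abelian_maps_def)
  show ?thesis using I.m_comm assms by simp
qed

lemma subgroup_image: "subgroup (\<psi> ` carrier G) G"
  by (intro group_hom.img_is_subgroup group_hom.intro group_hom_axioms.intro psi_hom is_group)

lemma phi_eq: "\<phi> g = g \<otimes> inv (\<psi> g)"
  by (simp add: map_diff_def map_plus_def map_neg_def)

lemma phi_pow_closed [simp]: "g \<in> carrier G \<Longrightarrow> (\<phi> ^^ n) g \<in> carrier G"
  by (induction n) (auto simp: phi_eq)

lemma psi_seq_eq: "psi_seq G \<psi> n g = inv ((\<phi> ^^ n) g) \<otimes> g"
  by (simp add: psi_seq_def map_plus_def map_neg_def)

lemma phi_pow_eq: "g \<in> carrier G \<Longrightarrow> (\<phi> ^^ n) g = g \<otimes> inv (psi_seq G \<psi> n g)"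
  by (simp add: psi_seq_eq inv_mult_group flip: m_assoc)

lemma psi_seq_closed [simp]: "g \<in> carrier G \<Longrightarrow> psi_seq G \<psi> n g \<in> carrier G"
  by (simp add: psi_seq_eq)

text \<open>Splitting off the last application of \<open>\<phi>\<close> exhibits psi_{n+1}(g) as
  psi_n(g) times an element of psi(G), which is what the inductions below use.\<close>

lemma psi_seq_Suc:
  assumes [simp]: "g \<in> carrier G"
  shows "psi_seq G \<psi> (Suc n) g = \<psi> ((\<phi> ^^ n) g) \<otimes> psi_seq G \<psi> n g"
  by (simp add: psi_seq_eq phi_eq[of "(\<phi> ^^ n) g"] inv_mult_group m_assoc)

lemma psi_seq_image: "g \<in> carrier G \<Longrightarrow> psi_seq G \<psi> n g \<in> \<psi> ` carrier G"
proof (induction n)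
  case 0
  then show ?case
    using subgroup.one_closed[OF subgroup_image] by (simp add: psi_seq_eq)
next
  case (Suc n)
  then show ?case
    by (simp add: psi_seq_Suc subgroup.m_closed[OF subgroup_image])
qed

text \<open>Although \<open>\<phi>\<close> is not multiplicative, psi after
  \<open>\<phi> ^^ n\<close> is: psi ignores the order of factors because its image is abelian. The
  recursion then leaves four commuting elements of psi(G) to rearrange.\<close>

lemma psi_seq_mult:
  assumes "g \<in> carrier G" "h \<in> carrier G"
  shows "psi_seq G \<psi> n (g \<otimes> h) = psi_seq G \<psi> n g \<otimes> psi_seq G \<psi> n h"
proof (induction n)
  case 0
  then show ?case using assms by (simp add: psi_seq_eq)
next
  case (Suc n)
  define a where "a = psi_seq G \<psi> n g"
  define b where "b = psi_seq G \<psi> n h"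
  define c where "c = \<psi> ((\<phi> ^^ n) g)"
  define d where "d = \<psi> ((\<phi> ^^ n) h)"
  have im: "a \<in> \<psi> ` carrier G" "b \<in> \<psi> ` carrier G" "c \<in> \<psi> ` carrier G" "d \<in> \<psi> ` carrier G"
    using assms by (auto simp: a_def b_def c_def d_def psi_seq_image)
  then have [simp]: "a \<in> carrier G" "b \<in> carrier G" "c \<in> carrier G" "d \<in> carrier G"
    by auto
  have "\<psi> (inv a) \<in> \<psi> ` carrier G" "\<psi> (inv b) \<in> \<psi> ` carrier G" "\<psi> h \<in> \<psi> ` carrier G"
    using assms by auto
  then have "\<psi> h \<otimes> \<psi> (inv b) \<otimes> \<psi> (inv a) = \<psi> (inv a) \<otimes> (\<psi> h \<otimes> \<psi> (inv b))"
    using assms by (intro image_commute) (auto intro: subgroup.m_closed[OF subgroup_image])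
  then have "\<psi> ((\<phi> ^^ n) (g \<otimes> h)) = c \<otimes> d"
    using assms by (simp add: phi_pow_eq Suc psi_mult inv_mult_group m_assoc c_def d_def flip: a_def b_def)
  then have "psi_seq G \<psi> (Suc n) (g \<otimes> h) = c \<otimes> d \<otimes> (a \<otimes> b)"
    using assms by (simp add: psi_seq_Suc Suc a_def b_def)
  also have "\<dots> = c \<otimes> (d \<otimes> a) \<otimes> b"
    by (simp add: m_assoc)
  also have "d \<otimes> a = a \<otimes> d"
    using im by (intro image_commute)
  also have "c \<otimes> (a \<otimes> d) \<otimes> b = (c \<otimes> a) \<otimes> (d \<otimes> b)"
    by (simp add: m_assoc)
  finally show ?case
    using assms by (simp add: psi_seq_Suc a_def b_def c_def d_def)
qed

lemma psi_seq_commute: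
  assumes "g \<in> carrier G" "h \<in> carrier G"
  shows "psi_seq G \<psi> m g \<otimes> psi_seq G \<psi> n h = psi_seq G \<psi> n h \<otimes> psi_seq G \<psi> m g"
  using assms by (intro image_commute psi_seq_image)

lemma psi_seq_hom: "psi_seq G \<psi> n \<in> hom G G"
  by (auto intro: homI simp: psi_seq_mult)

lemma psi_seq_inv: "g \<in> carrier G \<Longrightarrow> psi_seq G \<psi> n (inv g) = inv (psi_seq G \<psi> n g)"
  by (intro group_hom.hom_inv group_hom.intro group_hom_axioms.intro psi_seq_hom is_group)

lemma circ_op_eq:
  "g \<in> carrier G \<Longrightarrow> circ_op G \<psi> n g h = g \<otimes> inv (psi_seq G \<psi> n g) \<otimes> h \<otimes> psi_seq G \<psi> n g"
  by (simp add: circ_op_def psi_seq_inv)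

lemma circ_op_eq_phi_pow:
  "g \<in> carrier G \<Longrightarrow> circ_op G \<psi> n g h = (\<phi> ^^ n) g \<otimes> h \<otimes> psi_seq G \<psi> n g"
  by (simp add: circ_op_eq phi_pow_eq)

lemma circ_op_closed [simp]:
  "g \<in> carrier G \<Longrightarrow> h \<in> carrier G \<Longrightarrow> circ_op G \<psi> n g h \<in> carrier G"
  by (simp add: circ_op_def)

text \<open>The operation only inserts a conjugation by psi_n(g), which is invisible to a
  homomorphism with abelian image. The indices m and n are independent, as the brace relation mixes
  two operations.\<close>

lemma psi_seq_circ_op:
  assumes [simp]: "g \<in> carrier G" "h \<in> carrier G"
  shows "psi_seq G \<psi> m (circ_op G \<psi> n g h) = psi_seq G \<psi> m g \<otimes> psi_seq G \<psi> m h"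
proof -
  let ?a = "psi_seq G \<psi> n g"
  have "psi_seq G \<psi> m h \<otimes> psi_seq G \<psi> m ?a = psi_seq G \<psi> m ?a \<otimes> psi_seq G \<psi> m h"
    by (simp add: psi_seq_commute)
  then show ?thesis
    by (simp add: circ_op_eq psi_seq_mult psi_seq_inv m_assoc)
      (simp flip: m_assoc)
qed

text \<open>Both sides reduce to x a^-1 y b^-1 z b a, because the conjugator of the product of x and
  y is ab = ba.\<close>

lemma circ_op_assoc:
  assumes [simp]: "x \<in> carrier G" "y \<in> carrier G" "z \<in> carrier G"
  shows "circ_op G \<psi> n (circ_op G \<psi> n x y) z = circ_op G \<psi> n x (circ_op G \<psi> n y z)"
proof -
  define a where "a = psi_seq G \<psi> n x"
  define b where "b = psi_seq G \<psi> n y"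
  have [simp]: "a \<in> carrier G" "b \<in> carrier G" and ab: "a \<otimes> b = b \<otimes> a"
    by (auto simp: a_def b_def psi_seq_commute)
  have "circ_op G \<psi> n (circ_op G \<psi> n x y) z =
      x \<otimes> inv a \<otimes> y \<otimes> a \<otimes> inv (b \<otimes> a) \<otimes> z \<otimes> (b \<otimes> a)"
    using ab by (simp add: circ_op_eq[of "circ_op G \<psi> n x y"] psi_seq_circ_op flip: a_def b_def)
      (simp add: circ_op_eq flip: a_def b_def)
  also have "\<dots> = x \<otimes> inv a \<otimes> (y \<otimes> inv b \<otimes> z \<otimes> b) \<otimes> a"
    by (simp add: inv_mult_group m_assoc flip: m_assoc[of a "inv a"])
  finally show ?thesis
    by (simp add: circ_op_eq a_def b_def)
qed

lemma psi_seq_one [simp]: "psi_seq G \<psi> n \<one> = \<one>"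
  by (intro group_hom.hom_one group_hom.intro group_hom_axioms.intro psi_seq_hom is_group)

lemma circ_group_simps [simp]:
  "carrier (circ_group G \<psi> n) = carrier G" "\<one>\<^bsub>circ_group G \<psi> n\<^esub> = \<one>"
  "x \<otimes>\<^bsub>circ_group G \<psi> n\<^esub> y = circ_op G \<psi> n x y"
  by (auto simp: circ_group_def)

text \<open>The argument is the inverse of x for the n-th operation; under psi_m its conjugation
  disappears.\<close>

lemma psi_seq_conj_inv:
  assumes [simp]: "x \<in> carrier G"
  shows "psi_seq G \<psi> m (psi_seq G \<psi> n x \<otimes> inv x \<otimes> inv (psi_seq G \<psi> n x)) = inv (psi_seq G \<psi> m x)"
proof -
  let ?a = "psi_seq G \<psi> n x"
  have "psi_seq G \<psi> m ?a \<otimes> psi_seq G \<psi> m (inv x) = psi_seq G \<psi> m (inv x) \<otimes> psi_seq G \<psi> m ?a"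
    by (simp add: psi_seq_commute)
  then show ?thesis
    by (simp add: psi_seq_mult psi_seq_inv) (simp add: m_assoc)
qed

lemma circ_op_inv:
  assumes [simp]: "x \<in> carrier G"
  shows "circ_op G \<psi> n x (psi_seq G \<psi> n x \<otimes> inv x \<otimes> inv (psi_seq G \<psi> n x)) = \<one>"
  by (simp add: circ_op_eq m_assoc flip: m_assoc[of "inv (psi_seq G \<psi> n x)"])

lemma group_circ_group: "group (circ_group G \<psi> n)"
proof (rule groupI)
  fix x assume "x \<in> carrier (circ_group G \<psi> n)"
  then have [simp]: "x \<in> carrier G" by simp
  define a where "a = psi_seq G \<psi> n x"
  have [simp]: "a \<in> carrier G" by (simp add: a_def)
  \<comment> \<open>Found by solving x a^-1 y a = 1 for y; since psi_n sends it to a^-1, it is a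
    left inverse too.\<close>
  let ?y = "a \<otimes> inv x \<otimes> inv a"
  have "psi_seq G \<psi> n ?y = inv a"
    by (simp add: psi_seq_conj_inv a_def)
  then have "circ_op G \<psi> n ?y x = \<one>"
    by (simp add: circ_op_eq m_assoc flip: m_assoc[of "inv a" a])
  then show "\<exists>y\<in>carrier (circ_group G \<psi> n). y \<otimes>\<^bsub>circ_group G \<psi> n\<^esub> x = \<one>\<^bsub>circ_group G \<psi> n\<^esub>"
    by (intro bexI[of _ ?y]) auto
qed (auto simp: circ_op_assoc, simp add: circ_op_eq)

lemma inv_circ_group:
  assumes [simp]: "x \<in> carrier G"
  shows "inv\<^bsub>circ_group G \<psi> n\<^esub> x = psi_seq G \<psi> n x \<otimes> inv x \<otimes> inv (psi_seq G \<psi> n x)"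
proof -
  interpret C: group "circ_group G \<psi> n" by (rule group_circ_group)
  have "x \<otimes>\<^bsub>circ_group G \<psi> n\<^esub> (psi_seq G \<psi> n x \<otimes> inv x \<otimes> inv (psi_seq G \<psi> n x)) = \<one>\<^bsub>circ_group G \<psi> n\<^esub>"
    by (simp add: circ_op_inv)
  then show ?thesis
    by (intro C.inv_equality[OF C.inv_comm]) auto
qed

text \<open>Expanded in \<open>G\<close>, both sides of the brace relation are x b^-1 y c^-1 z c b;
  the rearrangement rests on b and c commuting.\<close>

theorem brace_block_circ_group: "brace_block (circ_group G \<psi>)"
proof -
  have "circ_op G \<psi> n x (circ_op G \<psi> m y z) =
      circ_op G \<psi> m (circ_op G \<psi> m (circ_op G \<psi> n x y) (inv\<^bsub>circ_group G \<psi> m\<^esub> x)) (circ_op G \<psi> n x z)"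
    (is "_ = circ_op G \<psi> m ?w _")
    if [simp]: "x \<in> carrier G" "y \<in> carrier G" "z \<in> carrier G" for m n x y z
  proof -
    define a where "a = psi_seq G \<psi> m x"
    define b where "b = psi_seq G \<psi> n x"
    define c where "c = psi_seq G \<psi> m y"
    have [simp]: "a \<in> carrier G" "b \<in> carrier G" "c \<in> carrier G"
      and ac: "a \<otimes> c = c \<otimes> a" and bc: "c \<otimes> b = b \<otimes> c"
      by (auto simp: a_def b_def c_def psi_seq_commute)
    have inv_x: "inv\<^bsub>circ_group G \<psi> m\<^esub> x = a \<otimes> inv x \<otimes> inv a"
      by (simp add: inv_circ_group a_def)
    have psi_inv_x: "psi_seq G \<psi> m (inv\<^bsub>circ_group G \<psi> m\<^esub> x) = inv a"
      by (simp add: inv_circ_group psi_seq_conj_inv a_def)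
    have [simp]: "inv\<^bsub>circ_group G \<psi> m\<^esub> x \<in> carrier G"
      by (simp add: inv_x)
    \<comment> \<open>The contributions of x and of its inverse cancel, so the outer operation
      conjugates by c alone.\<close>
    have psi_w: "psi_seq G \<psi> m ?w = c"
      by (simp add: psi_seq_circ_op psi_inv_x ac flip: a_def c_def)
        (simp add: m_assoc)
    have "?w = x \<otimes> inv b \<otimes> y \<otimes> b \<otimes> inv (a \<otimes> c) \<otimes> (a \<otimes> inv x \<otimes> inv a) \<otimes> (a \<otimes> c)"
      by (simp add: circ_op_eq[of "circ_op G \<psi> n x y"] psi_seq_circ_op inv_x flip: a_def c_def)
        (simp add: circ_op_eq flip: b_def)
    also have "\<dots> = x \<otimes> inv b \<otimes> y \<otimes> b \<otimes> inv c \<otimes> inv x \<otimes> c"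
      by (simp add: inv_mult_group m_assoc flip: m_assoc[of a "inv a"] m_assoc[of "inv a" a])
    finally have w: "?w = x \<otimes> inv b \<otimes> y \<otimes> b \<otimes> inv c \<otimes> inv x \<otimes> c" .
    have outer: "circ_op G \<psi> m ?w v = ?w \<otimes> inv c \<otimes> v \<otimes> c" for v
      by (simp add: circ_op_eq[of ?w] psi_w)
    have "circ_op G \<psi> m ?w (circ_op G \<psi> n x z) =
        x \<otimes> inv b \<otimes> y \<otimes> b \<otimes> inv c \<otimes> inv x \<otimes> c \<otimes> inv c \<otimes> (x \<otimes> inv b \<otimes> z \<otimes> b) \<otimes> c"
      unfolding outer unfolding w unfolding circ_op_eq[OF \<open>x \<in> carrier G\<close>] b_def by (rule refl)
    also have "\<dots> = x \<otimes> inv b \<otimes> y \<otimes> b \<otimes> inv (b \<otimes> c) \<otimes> z \<otimes> (b \<otimes> c)"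
      by (simp add: inv_mult_group m_assoc flip: m_assoc[of c "inv c"] m_assoc[of "inv x" x])
    also have "\<dots> = x \<otimes> inv b \<otimes> (y \<otimes> inv c \<otimes> z \<otimes> c) \<otimes> b"
      unfolding bc[symmetric]
      by (simp add: inv_mult_group m_assoc flip: m_assoc[of b "inv b"])
    finally show ?thesis
      by (simp add: circ_op_eq b_def c_def)
  qed
  then show ?thesis
    by (simp add: brace_block_def brace_def group_circ_group)
qed

end

subsection \<open>Semidirect products of cyclic groups\<close>

definition center :: "('a, 'b) monoid_scheme \<Rightarrow> 'a set" where
  "center G = {z \<in> carrier G. \<forall>x\<in>carrier G. z \<otimes>\<^bsub>G\<^esub> x = x \<otimes>\<^bsub>G\<^esub> z}"

lemma iso_image_center:
  assumes "f \<in> iso G H" and closed: "\<And>x y. x \<in> carrier G \<Longrightarrow> y \<in> carrier G \<Longrightarrow> x \<otimes>\<^bsub>G\<^esub> y \<in> carrier G"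
  shows "f ` center G = center H"
proof -
  have hom: "f \<in> hom G H" and inj: "inj_on f (carrier G)" and carrier_H: "carrier H = f ` carrier G"
    using assms(1) by (auto simp: iso_def bij_betw_def)
  have "f z \<in> center H \<longleftrightarrow> z \<in> center G" if "z \<in> carrier G" for z
    using that closed by (auto simp: center_def carrier_H inj_on_eq_iff[OF inj] simp flip: hom_mult[OF hom])
  then show ?thesis
    by (auto simp: center_def carrier_H)
qed

lemma (in group) iso_card_center:
  assumes "G \<cong> H"
  shows "card (center G) = card (center H)"
proof -
  obtain f where f: "f \<in> iso G H"
    using assms by (auto simp: is_iso_def)
  then have "inj_on f (center G)"
    by (auto simp: iso_def bij_betw_def center_def intro: inj_on_subset)
  then show ?thesis
    using iso_image_center[OF f] by (metis card_image m_closed)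
qed

text \<open>The congruence makes r^b modulo M depend only on b modulo K, so that Z_K acts on Z_M
  through powers of r.\<close>

locale cyclic_semidirect =
  fixes M K r :: nat
  assumes M_pos: "M > 0" and K_pos: "K > 0" and pow_cong: "[r ^ K = 1] (mod M)"
begin

text \<open>Pairs of residues are coded as numbers so that the group has type
  \<open>nat monoid\<close>, as the final statement demands.\<close>

definition G :: "nat monoid" where
  "G = \<lparr>carrier = prod_encode ` ({..<M} \<times> {..<K}),
    monoid.mult = (\<lambda>x y. case (prod_decode x, prod_decode y) of
      ((a, b), (c, d)) \<Rightarrow> prod_encode ((a + r ^ b * c) mod M, (b + d) mod K)),
    one = prod_encode (0, 0)\<rparr>"

text \<open>The map (a, b) to (0, -b). The outer \<open>mod K\<close> sends b = 0 to 0 instead of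
  K.\<close>

definition \<psi> :: "nat \<Rightarrow> nat" where
  "\<psi> x = (case prod_decode x of (a, b) \<Rightarrow> prod_encode (0, (K - b) mod K))"

lemma G_simps [simp]:
  "prod_encode (a, b) \<in> carrier G \<longleftrightarrow> a < M \<and> b < K"
  "prod_encode (a, b) \<otimes>\<^bsub>G\<^esub> prod_encode (c, d) = prod_encode ((a + r ^ b * c) mod M, (b + d) mod K)"
  "\<one>\<^bsub>G\<^esub> = prod_encode (0, 0)"
  by (auto simp: G_def)

lemma carrierE:
  assumes "x \<in> carrier G"
  obtains a b where "x = prod_encode (a, b)" "a < M" "b < K"
  using assms by (auto simp: G_def)

lemma ball_carrier: "(\<forall>x\<in>carrier G. P x) \<longleftrightarrow> (\<forall>a<M. \<forall>b<K. P (prod_encode (a, b)))"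
  by (auto simp: G_def)

lemma finite_carrier: "finite (carrier G)"
  by (simp add: G_def)

lemma psi_encode [simp]: "\<psi> (prod_encode (a, b)) = prod_encode (0, (K - b) mod K)"
  by (simp add: \<psi>_def)

lemma cong_pow_mod: "[r ^ (k mod K) = r ^ k] (mod M)"
proof -
  have "[r ^ k = (r ^ K) ^ (k div K) * r ^ (k mod K)] (mod M)"
    by (simp flip: power_mult power_add)
  also have "[(r ^ K) ^ (k div K) * r ^ (k mod K) = 1 ^ (k div K) * r ^ (k mod K)] (mod M)"
    by (intro cong_mult cong_pow pow_cong cong_refl)
  finally show ?thesis
    by (simp add: cong_sym)
qed

lemma group_G: "group G"
proof (rule groupI)
  fix x y z assume "x \<in> carrier G" "y \<in> carrier G" "z \<in> carrier G"
  then obtain a b c d e f where xyz: "x = prod_encode (a, b)" "y = prod_encode (c, d)" "z = prod_encode (e, f)"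
    by (meson carrierE)
  have "[(a + r ^ b * c) mod M + r ^ ((b + d) mod K) * e = (a + r ^ b * c) + r ^ (b + d) * e] (mod M)"
    by (intro cong_add cong_mult cong_pow_mod cong_refl) auto
  also have "(a + r ^ b * c) + r ^ (b + d) * e = a + r ^ b * (c + r ^ d * e)"
    by (simp add: algebra_simps power_add)
  also have "[a + r ^ b * (c + r ^ d * e) = a + r ^ b * ((c + r ^ d * e) mod M)] (mod M)"
    by (intro cong_add cong_mult cong_refl) (auto simp: cong_def)
  finally show "x \<otimes>\<^bsub>G\<^esub> y \<otimes>\<^bsub>G\<^esub> z = x \<otimes>\<^bsub>G\<^esub> (y \<otimes>\<^bsub>G\<^esub> z)"
    by (simp add: xyz cong_def mod_simps add.assoc)
next
  fix x assume "x \<in> carrier G"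
  then obtain a b where x: "x = prod_encode (a, b)" "a < M" "b < K"
    by (rule carrierE)
  \<comment> \<open>The inverse (-r^(-b) a, -b), with r^(-b) written as r^(K - b) and -a as M - a to
    stay within the naturals.\<close>
  let ?y = "prod_encode ((r ^ (K - b) * (M - a)) mod M, (K - b) mod K)"
  have "[(r ^ (K - b) * (M - a)) mod M + r ^ ((K - b) mod K) * a = r ^ (K - b) * (M - a) + r ^ (K - b) * a] (mod M)"
    by (intro cong_add cong_mult cong_pow_mod cong_refl) auto
  also have "r ^ (K - b) * (M - a) + r ^ (K - b) * a = r ^ (K - b) * M"
    using x by (simp flip: distrib_left)
  finally have "?y \<otimes>\<^bsub>G\<^esub> x = \<one>\<^bsub>G\<^esub>"
    using x by (simp add: cong_def mod_simps)
  then show "\<exists>y\<in>carrier G. y \<otimes>\<^bsub>G\<^esub> x = \<one>\<^bsub>G\<^esub>"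
    using M_pos K_pos by (intro bexI[of _ ?y]) auto
qed (use M_pos K_pos in \<open>auto elim!: carrierE\<close>)

sublocale group G by (rule group_G)

lemma psi_abelian: "\<psi> \<in> abelian_maps G"
proof -
  have hom: "\<psi> \<in> hom G G"
  proof (rule homI)
    fix x y assume "x \<in> carrier G" "y \<in> carrier G"
    then obtain a b c d where xy: "x = prod_encode (a, b)" "b < K" "y = prod_encode (c, d)" "d < K"
      by (meson carrierE)
    \<comment> \<open>Additivity of negation is checked over the integers, where the truncated
      differences become genuine ones.\<close>
    have "[int (K - (b + d) mod K) = int (K - b) + int (K - d)] (mod int K)"
      using xy K_pos by (simp add: of_nat_diff zmod_int cong_def mod_simps less_imp_le)
    then have "[K - (b + d) mod K = (K - b) + (K - d)] (mod K)"
      by (simp flip: cong_int_iff)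
    then show "\<psi> (x \<otimes>\<^bsub>G\<^esub> y) = \<psi> x \<otimes>\<^bsub>G\<^esub> \<psi> y"
      by (simp add: xy cong_def mod_simps)
  qed (use M_pos K_pos in \<open>auto elim!: carrierE\<close>)
  have "subgroup (\<psi> ` carrier G) G"
    by (intro group_hom.img_is_subgroup group_hom.intro group_hom_axioms.intro hom is_group)
  then have "group (G\<lparr>carrier := \<psi> ` carrier G\<rparr>)"
    by (rule subgroup.subgroup_is_group) (rule is_group)
  then have "comm_group (G\<lparr>carrier := \<psi> ` carrier G\<rparr>)"
    by (rule group.group_comm_groupI) (auto elim!: carrierE simp: add.commute)
  with hom show ?thesis
    by (simp add: abelian_maps_def)
qed

sublocale abelian_map G \<psi>
  by unfold_locales (rule psi_abelian)

text \<open>One step multiplies (a, e) by the inverse of (0, -e), that is by (0, e), which doubles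
  the second coordinate and keeps the first.\<close>

lemma phi_pow_encode:
  assumes "a < M" "b < K"
  shows "((map_diff G id \<psi>) ^^ n) (prod_encode (a, b)) = prod_encode (a, 2 ^ n * b mod K)"
proof (induction n)
  case (Suc n)
  have phi: "map_diff G id \<psi> (prod_encode (a, e)) = prod_encode (a, (e + e) mod K)" if "e < K" for e
  proof -
    have "inv\<^bsub>G\<^esub> (prod_encode (0, (K - e) mod K)) = prod_encode (0, e)"
      using that M_pos K_pos by (intro inv_equality) (auto simp: mod_simps)
    then show ?thesis
      using that assms by (simp add: phi_eq)
  qed
  have "((map_diff G id \<psi>) ^^ Suc n) (prod_encode (a, b)) =
      map_diff G id \<psi> (prod_encode (a, 2 ^ n * b mod K))"
    by (simp only: funpow.simps comp_apply Suc.IH)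
  also have "\<dots> = prod_encode (a, (2 ^ n * b mod K + 2 ^ n * b mod K) mod K)"
    using K_pos by (intro phi) simp
  finally show ?case
    by (simp only: mod_add_eq power_Suc mult_2 distrib_right)
qed (use assms in auto)

text \<open>The second coordinate is (1 - 2^n) b modulo K, with K - 1 standing for -1.\<close>

lemma psi_seq_encode:
  assumes "a < M" "b < K"
  shows "psi_seq G \<psi> n (prod_encode (a, b)) = prod_encode (0, (b + (K - 1) * (2 ^ n * b)) mod K)"
proof -
  have "2 ^ n * b + (b + (K - 1) * (2 ^ n * b)) = b + K * (2 ^ n * b)"
    using K_pos by (cases K) auto
  then have "(2 ^ n * b mod K + (b + (K - 1) * (2 ^ n * b)) mod K) mod K = b"
    using assms by (simp only: mod_add_eq) simp
  then show ?thesis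
    using assms K_pos M_pos by (simp add: psi_seq_eq phi_pow_encode inv_solve_left' mod_simps)
qed

text \<open>The left factor \<open>\<phi> ^^ n\<close> puts 2^n b into the exponent of r, and the
  right factor psi_n restores the sum b + d without touching the first coordinate.\<close>

lemma circ_op_encode:
  assumes "a < M" "b < K" "c < M" "d < K"
  shows "circ_op G \<psi> n (prod_encode (a, b)) (prod_encode (c, d)) =
    prod_encode ((a + r ^ (2 ^ n * b) * c) mod M, (b + d) mod K)"
proof -
  have "circ_op G \<psi> n (prod_encode (a, b)) (prod_encode (c, d)) =
    prod_encode (a, 2 ^ n * b mod K) \<otimes>\<^bsub>G\<^esub> prod_encode (c, d) \<otimes>\<^bsub>G\<^esub>
    prod_encode (0, (b + (K - 1) * (2 ^ n * b)) mod K)"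
    using assms by (simp add: circ_op_eq_phi_pow phi_pow_encode psi_seq_encode del: G_simps(2))
  moreover have "((2 ^ n * b mod K + d) mod K + (b + (K - 1) * (2 ^ n * b)) mod K) mod K = (b + d) mod K"
  proof -
    have eq: "2 ^ n * b + d + (b + (K - 1) * (2 ^ n * b)) = b + d + K * (2 ^ n * b)"
      using K_pos by (cases K) auto
    have "((2 ^ n * b mod K + d) mod K + (b + (K - 1) * (2 ^ n * b)) mod K) mod K =
        (2 ^ n * b + d + (b + (K - 1) * (2 ^ n * b))) mod K"
      by (simp add: mod_simps)
    also have "\<dots> = (b + d) mod K"
      unfolding eq by simp
    finally show ?thesis .
  qed
  moreover have "[a + r ^ (2 ^ n * b mod K) * c = a + r ^ (2 ^ n * b) * c] (mod M)"
    by (intro cong_add cong_mult cong_pow_mod cong_refl)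
  ultimately show ?thesis
    by (simp add: cong_def mod_simps)
qed

text \<open>Commuting with (c, d) is a single congruence; d = 0 and c = 0 split it into two: b acts
  trivially, and a is fixed by the action.\<close>

lemma center_circ_group_iff:
  assumes "a < M" "b < K"
  shows "prod_encode (a, b) \<in> center (circ_group G \<psi> n) \<longleftrightarrow>
    (\<forall>c<M. [r ^ (2 ^ n * b) * c = c] (mod M)) \<and> (\<forall>d<K. [r ^ (2 ^ n * d) * a = a] (mod M))"
    (is "?l \<longleftrightarrow> ?c \<and> ?d")
proof -
  have "?l \<longleftrightarrow> (\<forall>c<M. \<forall>d<K. [a + r ^ (2 ^ n * b) * c = c + r ^ (2 ^ n * d) * a] (mod M))"
    using assms by (simp add: center_def ball_carrier circ_op_encode add.commute cong_def)
  also have "\<dots> \<longleftrightarrow> ?c \<and> ?d"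
  proof safe
    assume *: "\<forall>c<M. \<forall>d<K. [a + r ^ (2 ^ n * b) * c = c + r ^ (2 ^ n * d) * a] (mod M)"
    show "[r ^ (2 ^ n * b) * c = c] (mod M)" if "c < M" for c
      using *[rule_format, OF that K_pos] by (simp add: add.commute[of a] cong_add_rcancel_nat)
    show "[r ^ (2 ^ n * d) * a = a] (mod M)" if "d < K" for d
      using *[rule_format, OF M_pos that] by (simp add: cong_sym)
  next
    fix c d assume "?c" "?d" "c < M" "d < K"
    then have "[a + r ^ (2 ^ n * b) * c = r ^ (2 ^ n * d) * a + c] (mod M)"
      by (intro cong_add) (auto intro: cong_sym)
    then show "[a + r ^ (2 ^ n * b) * c = c + r ^ (2 ^ n * d) * a] (mod M)"
      by (simp add: add.commute)
  qed
  finally show ?thesis .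
qed

text \<open>Passing from n to n + 1 squares every acting power of r, and whatever a power fixes its
  square fixes.\<close>

lemma center_mono_Suc: "center (circ_group G \<psi> n) \<subseteq> center (circ_group G \<psi> (Suc n))"
proof
  fix x assume x: "x \<in> center (circ_group G \<psi> n)"
  then obtain a b where ab: "x = prod_encode (a, b)" "a < M" "b < K"
    by (auto simp: center_def elim: carrierE)
  have sq: "[r ^ (2 ^ Suc n * e) * c = c] (mod M)" if "[r ^ (2 ^ n * e) * c = c] (mod M)" for e c
  proof -
    have "r ^ (2 ^ Suc n * e) * c = r ^ (2 ^ n * e) * (r ^ (2 ^ n * e) * c)"
      by (simp add: mult_2 distrib_right power_add)
    also have "[\<dots> = r ^ (2 ^ n * e) * c] (mod M)"
      using that by (intro cong_mult cong_refl)
    finally show ?thesis using that by (rule cong_trans)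
  qed
  show "x \<in> center (circ_group G \<psi> (Suc n))"
    using x ab sq by (simp add: center_circ_group_iff)
qed

end


section \<open>A concrete block whose centers grow strictly\<close>

lemma ex_abelian_map_many_circ_groups:
  fixes N :: nat
  assumes "N > 0"
  obtains G :: "nat monoid" and \<psi> where
    "group G" "finite (carrier G)" "\<not> comm_group G" "\<psi> \<in> abelian_maps G"
    "pairwise (\<lambda>m n. \<not> circ_group G \<psi> m \<cong> circ_group G \<psi> n) {..N}"
proof -
  \<comment> \<open>M divides 2^K - 1, so r = 2 is admissible; K = 2^N leaves room for N doublings
    before the action becomes trivial.\<close>
  define K M :: nat where "K = 2 ^ N" and "M = 2 ^ K - 1"
  have "K \<ge> 2"
    using assms self_le_power[of "2::nat" N] by (simp add: K_def)
  then have "(2::nat) ^ 2 \<le> 2 ^ K"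
    by (intro power_increasing) auto
  then have M: "M \<ge> 3" and M_Suc: "2 ^ K = M + 1"
    by (auto simp: M_def)
  interpret cyclic_semidirect M K 2
    using M \<open>K \<ge> 2\<close> by unfold_locales (auto simp: M_Suc cong_def mod_Suc)
  let ?Z = "\<lambda>n. center (circ_group G \<psi> n)"
  have psubset: "?Z n \<subset> ?Z (Suc n)" if "n < N" for n
  proof -
    \<comment> \<open>Chosen so that 2^n b = K/2: the element (0, b) acts as 2^(K/2) at stage n but
      as 2^K = 1 at stage n + 1, so it is central only from then on.\<close>
    define b :: nat where "b = 2 ^ (N - 1 - n)"
    have b: "2 ^ n * b = 2 ^ (N - 1)"
      using that by (simp add: b_def flip: power_add)
    have K_half: "K = 2 ^ (N - 1) + 2 ^ (N - 1)"
      using assms by (cases N) (auto simp: K_def)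
    have "b \<le> 2 ^ (N - 1)"
      unfolding b_def by (intro power_increasing) auto
    then have "b < K"
      using K_half zero_less_power[of "2::nat" "N - 1"] by linarith
    have "2 ^ (Suc n) * b = K"
      using b K_half by simp
    then have "prod_encode (0, b) \<in> ?Z (Suc n)"
      using M \<open>b < K\<close> cong_mult[OF pow_cong cong_refl]
      by (simp add: center_circ_group_iff del: power_Suc)
    moreover have "prod_encode (0, b) \<notin> ?Z n"
    proof
      \<comment> \<open>Here t = 2^(K/2) and M = t^2 - 1, so 1 < t < M and t cannot be 1 modulo M.
        The congruence for t is the centrality condition at c = 1.\<close>
      define t :: nat where "t = 2 ^ 2 ^ (N - 1)"
      assume "prod_encode (0, b) \<in> ?Z n"
      then have "[t = 1] (mod M)"
        using M \<open>b < K\<close> unfolding center_circ_group_iff[of 0 b, OF M_pos \<open>b < K\<close>] b t_def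
        by (auto dest: spec[of _ 1])
      moreover have "t \<ge> 2"
        using self_le_power[of "2::nat" "2 ^ (N - 1)"] by (simp add: t_def)
      moreover from this have "t * 2 \<le> t * t"
        by simp
      moreover have "M = t * t - 1"
        by (simp add: M_def K_half t_def power_add)
      ultimately have "t < M" "t \<noteq> 1"
        by linarith+
      with \<open>[t = 1] (mod M)\<close> M show False
        by (simp add: cong_def)
    qed
    ultimately show ?thesis
      using center_mono_Suc[of n] by blast
  qed
  have finite_Z: "finite (?Z n)" for n
    by (rule finite_subset[OF _ finite_carrier]) (auto simp: center_def)
  have "card (?Z m) < card (?Z n)" if "m < n" "n \<le> N" for m n
    using that
  proof (induction n)
    case (Suc n)
    then have "card (?Z n) < card (?Z (Suc n))"
      by (intro psubset_card_mono finite_Z psubset) auto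
    with Suc show ?case
      by (cases "m = n") auto
  qed auto
  then have "card (?Z m) \<noteq> card (?Z n)" if "m \<le> N" "n \<le> N" "m \<noteq> n" for m n
    using that by (cases m n rule: linorder_cases) (force dest: less_imp_neq)+
  then have noniso: "pairwise (\<lambda>m n. \<not> circ_group G \<psi> m \<cong> circ_group G \<psi> n) {..N}"
    by (auto simp: pairwise_def dest: group.iso_card_center[OF group_circ_group])
  have "\<not> comm_group G"
  proof
    assume "comm_group G"
    then interpret comm_group G .
    show False
      \<comment> \<open>The two products are (1, 1) and (2, 1), which differ because M is at least
        3.\<close>
      using m_comm[of "prod_encode (1, 0)" "prod_encode (0, 1)"] M \<open>K \<ge> 2\<close> by simp
  qed
  then show ?thesis
    using that group_G finite_carrier psi_abelian noniso by blast
qed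

lemma card_brace_solutions_pos: "card (brace_solutions A C) \<ge> 1"
  by (simp add: brace_solutions_def card_insert_if)

theorem mainTheorem3:
  "(\<forall>N::nat. N > 0 \<longrightarrow>
      (\<exists>(G :: nat monoid) \<psi>.
         group G \<and> finite (carrier G) \<and> \<not> comm_group G \<and> \<psi> \<in> abelian_maps G \<and>
         brace_block (circ_group G \<psi>) \<and>
         (\<exists>S :: nat set. finite S \<and> card S \<ge> N \<and>
            pairwise (\<lambda>m n. \<not> circ_group G \<psi> m \<cong> circ_group G \<psi> n) S)))
   \<and>
   (\<forall>N::nat. N > 0 \<longrightarrow>
      (\<exists>(G :: nat monoid) \<psi>.
         group G \<and> finite (carrier G) \<and> \<not> comm_group G \<and> \<psi> \<in> abelian_maps G \<and>
         brace_block (circ_group G \<psi>) \<and>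
         (\<exists>S :: (nat \<times> nat) set. finite S \<and>
            pairwise (\<lambda>(m, n) (m', n').
               \<not> brace_isomorphic (circ_group G \<psi> m, circ_group G \<psi> n)
                                   (circ_group G \<psi> m', circ_group G \<psi> n')) S \<and>
            (\<forall>(m, n) \<in> S. \<forall>R \<in> brace_solutions (circ_group G \<psi> m) (circ_group G \<psi> n).
               YB_solution (carrier G) R) \<and>
            (\<Sum>(m, n) \<in> S. card (brace_solutions (circ_group G \<psi> m) (circ_group G \<psi> n))) \<ge> N)))"
  (is "(\<forall>N. _ \<longrightarrow> ?groups N) \<and> (\<forall>N. _ \<longrightarrow> ?solutions N)")
proof -
  have "?groups N \<and> ?solutions N" if "N > 0" for N
  proof -
    obtain G :: "nat monoid" and \<psi> where G: "group G" "finite (carrier G)" "\<not> comm_group G"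
        and psi: "\<psi> \<in> abelian_maps G"
        and noniso: "pairwise (\<lambda>m n. \<not> circ_group G \<psi> m \<cong> circ_group G \<psi> n) {..N}"
      using ex_abelian_map_many_circ_groups[OF \<open>N > 0\<close>] .
    interpret abelian_map G \<psi>
      using G(1) psi by (simp add: abelian_map_def abelian_map_axioms_def)
    have block: "brace_block (circ_group G \<psi>)"
      by (rule brace_block_circ_group)
    \<comment> \<open>The first group is fixed, so a brace isomorphism would restrict to an
      isomorphism of two distinct second groups. These N + 1 braces give at least N solutions,
      counting just one for each.\<close>
    let ?S = "{0::nat} \<times> {..N}"
    let ?sol = "\<lambda>m n. brace_solutions (circ_group G \<psi> m) (circ_group G \<psi> n)"
    have "pairwise (\<lambda>(m, n) (m', n').
        \<not> brace_isomorphic (circ_group G \<psi> m, circ_group G \<psi> n)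
                            (circ_group G \<psi> m', circ_group G \<psi> n')) ?S"
      using noniso by (auto simp: pairwise_def brace_isomorphic_def is_iso_def)
    moreover have "\<forall>(m, n) \<in> ?S. \<forall>R \<in> ?sol m n. YB_solution (carrier G) R"
      using block YB_solution_brace_solutions[of "circ_group G \<psi> _"]
      by (fastforce simp: brace_block_def)
    moreover have "(\<Sum>(m, n) \<in> ?S. card (?sol m n)) \<ge> N"
    proof -
      have "N \<le> (\<Sum>p \<in> ?S. 1)"
        by simp
      also have "\<dots> \<le> (\<Sum>(m, n) \<in> ?S. card (?sol m n))"
        by (intro sum_mono) (auto simp only: case_prod_beta card_brace_solutions_pos)
      finally show ?thesis .
    qed
    ultimately have "?solutions N"
      using G psi block by (intro exI[of _ G] exI[of _ \<psi>] conjI exI[of _ ?S]) auto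
    moreover have "?groups N"
      using G psi block noniso by (intro exI[of _ G] exI[of _ \<psi>] conjI exI[of _ "{..N}"]) auto
    ultimately show ?thesis by blast
  qed
  then show ?thesis by blast
qed

end
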